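(* Let $X$ be a complex Banach space and let $E,F\in L(X)$ be two invertible and positive operators. Suppose in addition that $T\in L(X)$ is such that $T^\dag_{E,F}$ and $T^{\sharp}$ exist. Let $k,l\ge 1$ be integers and $\lambda\in\mathbb C\setminus\{0\}$. Then each one of the following statements is equivalent to $T$ being weighted EP with weights $E$ and $F$: (i) $TT^{\sharp}T^{\dag}_{E,F}=T^{\dag}_{E,F}T^{\sharp}T$; (ii) $TT^{\dag}_{E,F}T^{\dag}_{E,F}T=T^{\dag}_{E,F}TTT^{\dag}_{E,F}$; (iii) $T^{\dag}_{E,F}T^{\sharp}T+TT^{\sharp}T^{\dag}_{E,F}=2T^{\dag}_{E,F}$; (iv) $(T^{\dag}_{E,F})^2T^{\sharp}=T^{\dag}_{E,F}T^{\sharp}T^{\dag}_{E,F}=T^{\sharp}(T^{\dag}_{E,F})^2$; (v) $T(T^{\dag}_{E,F})^2=T^{\sharp}=(T^{\dag}_{E,F})^2T$; (vi) $T^k=T^{\dag}_{E,F}TT^k=T^kTT^{\dag}_{E,F}$; (vii) $(T^{\dag}_{E,F})^k=(T^{\sharp})^k$; (viii) $(T^{\sharp})^k T^{\dag}_{E,F}=T^{\dag}_{E,F}(T^{\sharp})^k$; (ix) $T^k T^{\dag}_{E,F}=T^{\dag}_{E,F}T^k$; (x) $T^{2k-1}= T^{\dag}_{E,F} T^{2k+1}T^{\dag}_{E,F}$; (xi) $(T^{\sharp})^kT^{\dag}_{E,F}T=(T^{\dag}_{E,F})^k$; (xii) $T(T^{\dag}_{E,F})^{k+1}=(T^{\sharp})^k=(T^{\dag}_{E,F})^{k+1}T$;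 (xiii) $T^kTT^{\dag}_{E,F}+T^{\dag}_{E,F}TT^k=2T^k$; (xiv) $(T^{\sharp})^{k+l-1}=(T^{\dag}_{E,F})^l (T^{\sharp})^{k-1}= (T^{\sharp})^{k-1}(T^{\dag}_{E,F})^l$; (xv) $TT^{\dag}_{E,F}(T^{\sharp})^{k+l-1}=(T^{\dag}_{E,F})^k(T^{\sharp})^lT=(T^{\sharp})^lT(T^{\dag}_{E,F})^k$; (xvi) $TT^\dagger_{E,F}(T^k+\lambda T^\dagger_{E,F})=(T^k+\lambda T^\dagger_{E,F})TT^\dagger_{E,F}$; (xvii) $T^\dagger_{E,F}T(T^k+\lambda T^\dagger_{E,F})=(T^k+\lambda T^\dagger_{E,F})T^\dagger_{E,F}T$; (xviii) $R(T+\lambda T^\dagger_{E,E})=R(T+\lambda T^\dagger_{F,F})=R(\lambda T+T^3)$ and $N(T+\lambda T^\dagger_{E,E})=N(T+\lambda T^\dagger_{F,F})=N(\lambda T+T^3)$; (xix) $R(T+\lambda T^\dagger_{E,F})=R(\lambda T+T^3)$ and $N(T+\lambda T^\dagger_{E,F})=N(\lambda T+T^3)$.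
   Context: For a complex Banach space $X$, $L(X)$ is the Banach algebra of bounded linear operators on $X$ with the operator norm; $R(T)$ and $N(T)$ are the range and null space of $T\in L(X)$; $S^0=I$ for $S\in L(X)$. Let $A$ be a complex unital Banach algebra (here $A=L(X)$). An element $h\in A$ is hermitian if $\|\exp(ith)\|=1$ for all $t\in\mathbb R$ (for $t=0$ this entails $\|1\|=1$); $H(A)$ is the set of hermitian elements of $A$. An element $c\in A$ is positive if $V(c)=\{\varphi(c):\varphi\in A^*,\ \|\varphi\|\le 1,\ \varphi(1)=1\}\subset[0,\infty)$; equivalently, $c$ is hermitian and $\sigma(c)\subset[0,\infty)$. A positive element $c$ has a unique positive square root, denoted $c^{1/2}$. For $u\in A$ invertible and positive, $u^{-1/2}=(u^{1/2})^{-1}$, and $A^u$ denotes the Banach algebra $A$ endowed with the norm $\|x\|_u=\|u^{1/2}xu^{-1/2}\|$. An element $b\in A$ is a normalized generalized inverse of $a\in A$ if $aba=a$ and $bab=b$. Given $e,f\in A$ invertible and positive, $a$ is weighted Moore-Penrose invertible with weights $e$ and $f$ if there is a normalized generalized inverse $b$ of $a$ with $ab\in H(A^e)$ and $ba\in H(A^f)$; such $b$ is unique when it exists and is denoted $a^{\dag}_{e,f}$ (also written $a^{\dagger}_{e,f}$). The element $a$ is weighted EP with weights $e$ and $f$ if $a^{\dag}_{e,f}$ exists and commutes with $a$. The group inverse of $a$, denoted $a^{\sharp}$, is the (unique, when it exists) $b\in A$ with $aba=a$, $bab=b$, $ab=ba$. Convention: statement (xviii) includes the assertion that $T^\dagger_{E,E}$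 and $T^\dagger_{F,F}$ exist. *)

theory Defs
  imports "HOL-Analysis.Analysis"
begin

section \<open>Complex Banach spaces and complex unital Banach algebras\<close>

class complex_banach = banach +
  fixes scaleC :: "complex \<Rightarrow> 'a \<Rightarrow> 'a"  (infixr "*\<^sub>C" 75)
  assumes scaleC_add_right: "c *\<^sub>C (x + y) = c *\<^sub>C x + c *\<^sub>C y"
    and scaleC_add_left: "(c + d) *\<^sub>C x = c *\<^sub>C x + d *\<^sub>C x"
    and scaleC_scaleC: "c *\<^sub>C d *\<^sub>C x = (c * d) *\<^sub>C x"
    and scaleC_of_real: "complex_of_real r *\<^sub>C x = r *\<^sub>R x"
    and norm_scaleC: "norm (c *\<^sub>C x) = cmod c * norm x"

text \<open>No relation between \<open>0\<close> and \<open>1\<close> and no value of \<open>norm 1\<close> is imposed, so that the bounded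
  operators on the zero space form an instance. This rules out \<open>real_normed_algebra_1\<close>, hence
  also the library's \<open>exp\<close>.\<close>

class complex_banach_algebra = complex_banach + real_normed_algebra + monoid_mult +
  assumes mult_scaleC_left: "(c *\<^sub>C x) * y = c *\<^sub>C (x * y)"
    and mult_scaleC_right: "x * (c *\<^sub>C y) = c *\<^sub>C (x * y)"

section \<open>Hermitian and positive elements\<close>

definition banach_exp :: "'a::complex_banach_algebra \<Rightarrow> 'a" where
  "banach_exp x = (\<Sum>n. x ^ n /\<^sub>R fact n)"

text \<open>The norm is a parameter because the same algebra is considered under several equivalent
  norms; the exponential series does not depend on the choice.\<close>

definition hermitian_wrt :: "('a::complex_banach_algebra \<Rightarrow> real) \<Rightarrow> 'a \<Rightarrow> bool" where
  "hermitian_wrt N h \<longleftrightarrow> (\<forall>t::real. N (banach_exp ((\<i> * complex_of_real t) *\<^sub>C h)) = 1)"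

definition dual_unit_ball :: "('a::complex_banach \<Rightarrow> complex) set" where
  "dual_unit_ball =
     {\<phi>. bounded_linear \<phi> \<and> (\<forall>c x. \<phi> (c *\<^sub>C x) = c * \<phi> x) \<and> onorm \<phi> \<le> 1}"

definition numerical_range :: "'a::complex_banach_algebra \<Rightarrow> complex set" where
  "numerical_range c = {\<phi> c | \<phi>. \<phi> \<in> dual_unit_ball \<and> \<phi> 1 = 1}"

definition positive_elt :: "'a::complex_banach_algebra \<Rightarrow> bool" where
  "positive_elt c \<longleftrightarrow> numerical_range c \<subseteq> \<real>\<^sub>\<ge>\<^sub>0"

definition invertible_elt :: "'a::monoid_mult \<Rightarrow> bool" where
  "invertible_elt u \<longleftrightarrow> (\<exists>v. u * v = 1 \<and> v * u = 1)"

definition inverse_elt :: "'a::monoid_mult \<Rightarrow> 'a" where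
  "inverse_elt u = (THE v. u * v = 1 \<and> v * u = 1)"

definition has_positive_sqrt :: "'a::complex_banach_algebra \<Rightarrow> bool" where
  "has_positive_sqrt c \<longleftrightarrow> (\<exists>!r. positive_elt r \<and> r * r = c)"

definition positive_sqrt :: "'a::complex_banach_algebra \<Rightarrow> 'a" where
  "positive_sqrt c = (THE r. positive_elt r \<and> r * r = c)"

section \<open>Weighted Moore-Penrose inverse, group inverse, weighted EP elements\<close>

definition weighted_norm :: "'a::complex_banach_algebra \<Rightarrow> 'a \<Rightarrow> real" where
  "weighted_norm u x = norm (positive_sqrt u * x * inverse_elt (positive_sqrt u))"

text \<open>The two \<open>has_positive_sqrt\<close> conjuncts say that the square roots in the weighted norms
  exist, since otherwise \<open>positive_sqrt\<close> is an arbitrary value. They do not follow from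
  \<open>positive_elt\<close>: if \<open>\<complex>\<^sup>3\<close> carries a norm whose square is \<open>|x|\<^sup>2\<close> plus a small multiple of
  \<open>Re (x\<^sub>1^3 * x\<^sub>3 * cnj x\<^sub>2^4) / |x|^6\<close>, then \<open>diag (1, 2, 5)\<close> is positive and invertible, but its only
  square root with nonnegative spectrum, \<open>diag (1, sqrt 2, sqrt 5)\<close>, is not hermitian.\<close>

definition weighted_MP_inverse ::
    "'a::complex_banach_algebra \<Rightarrow> 'a \<Rightarrow> 'a \<Rightarrow> 'a \<Rightarrow> bool" where
  "weighted_MP_inverse e f a b \<longleftrightarrow>
     has_positive_sqrt e \<and> has_positive_sqrt f \<and>
     a * b * a = a \<and> b * a * b = b \<and>
     hermitian_wrt (weighted_norm e) (a * b) \<and> hermitian_wrt (weighted_norm f) (b * a)"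

definition weighted_MP_invertible :: "'a::complex_banach_algebra \<Rightarrow> 'a \<Rightarrow> 'a \<Rightarrow> bool" where
  "weighted_MP_invertible e f a \<longleftrightarrow> (\<exists>b. weighted_MP_inverse e f a b)"

definition weighted_MP :: "'a::complex_banach_algebra \<Rightarrow> 'a \<Rightarrow> 'a \<Rightarrow> 'a" where
  "weighted_MP e f a = (THE b. weighted_MP_inverse e f a b)"

definition weighted_EP :: "'a::complex_banach_algebra \<Rightarrow> 'a \<Rightarrow> 'a \<Rightarrow> bool" where
  "weighted_EP e f a \<longleftrightarrow>
     weighted_MP_invertible e f a \<and> a * weighted_MP e f a = weighted_MP e f a * a"

definition is_group_inverse :: "'a::monoid_mult \<Rightarrow> 'a \<Rightarrow> bool" where
  "is_group_inverse a b \<longleftrightarrow> a * b * a = a \<and> b * a * b = b \<and> a * b = b * a"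

definition group_invertible :: "'a::monoid_mult \<Rightarrow> bool" where
  "group_invertible a \<longleftrightarrow> (\<exists>b. is_group_inverse a b)"

definition group_inverse :: "'a::monoid_mult \<Rightarrow> 'a" where
  "group_inverse a = (THE b. is_group_inverse a b)"

section \<open>The Banach algebra of bounded complex-linear operators\<close>

typedef (overloaded) ('a::complex_banach) bop =
  "{T :: 'a \<Rightarrow>\<^sub>L 'a. \<forall>c x. blinfun_apply T (c *\<^sub>C x) = c *\<^sub>C blinfun_apply T x}"
  morphisms blinfun_of_bop Bop
proof
  show "id_blinfun \<in> {T :: 'a \<Rightarrow>\<^sub>L 'a. \<forall>c x. T (c *\<^sub>C x) = c *\<^sub>C T x}"
    by simp
qed

setup_lifting type_definition_bop

lift_definition bop_apply :: "'a::complex_banach bop \<Rightarrow> 'a \<Rightarrow> 'a" is blinfun_apply .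

lemma scaleC_scaleR_commute:
  fixes x :: "'a::complex_banach"
  shows "c *\<^sub>C r *\<^sub>R x = r *\<^sub>R c *\<^sub>C x"
  by (metis mult.commute scaleC_of_real scaleC_scaleC)

lemma scaleC_zero_right: "c *\<^sub>C (0::'a::complex_banach) = 0"
  by (metis add_cancel_right_right scaleC_add_right)

lemma scaleC_minus_right: "c *\<^sub>C (- x) = - (c *\<^sub>C (x::'a::complex_banach))"
  by (metis add.right_inverse minus_unique scaleC_add_right scaleC_zero_right)

lemma scaleC_diff_right: "c *\<^sub>C (x - y) = c *\<^sub>C x - c *\<^sub>C (y::'a::complex_banach)"
  by (metis diff_conv_add_uminus scaleC_add_right scaleC_minus_right)

lemma bounded_linear_scaleC_right: "bounded_linear (\<lambda>x::'a::complex_banach. c *\<^sub>C x)"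
  by (rule bounded_linear_intro[where K = "cmod c"])
    (simp_all add: scaleC_add_right scaleC_scaleR_commute norm_scaleC mult.commute)

lift_definition scaleC_blinfun :: "complex \<Rightarrow> ('a::complex_banach \<Rightarrow>\<^sub>L 'a) \<Rightarrow> ('a \<Rightarrow>\<^sub>L 'a)"
  is "\<lambda>c f x. c *\<^sub>C f x"
  by (rule bounded_linear_compose[OF bounded_linear_scaleC_right])

lemma norm_scaleC_blinfun: "norm (scaleC_blinfun c f) = cmod c * norm f"
proof -
  have le: "norm (scaleC_blinfun d g) \<le> cmod d * norm g" for d :: complex and g :: "'a \<Rightarrow>\<^sub>L 'a"
  proof (rule norm_blinfun_bound)
    show "0 \<le> cmod d * norm g" by simp
    show "norm (scaleC_blinfun d g x) \<le> cmod d * norm g * norm x" for x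
      by (simp add: scaleC_blinfun.rep_eq norm_scaleC mult.assoc mult_left_mono norm_blinfun)
  qed
  show ?thesis
  proof (cases "c = 0")
    case True
    then show ?thesis using le[of c f] by simp
  next
    case False
    have "scaleC_blinfun (inverse c) (scaleC_blinfun c f) = f"
      using False scaleC_of_real[of 1]
      by (intro blinfun_eqI) (simp add: scaleC_blinfun.rep_eq scaleC_scaleC)
    then have "norm f \<le> cmod (inverse c) * norm (scaleC_blinfun c f)"
      using le[of "inverse c" "scaleC_blinfun c f"] by simp
    then have "cmod c * norm f \<le> norm (scaleC_blinfun c f)"
      using False by (simp add: norm_divide field_simps)
    then show ?thesis using le[of c f] by simp
  qed
qed

instantiation bop :: (complex_banach) real_normed_algebra
begin
lift_definition zero_bop :: "'a bop" is 0 by (simp add: scaleC_zero_right)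
lift_definition plus_bop :: "'a bop \<Rightarrow> 'a bop \<Rightarrow> 'a bop" is plus
  by (simp add: blinfun.add_left scaleC_add_right)
lift_definition minus_bop :: "'a bop \<Rightarrow> 'a bop \<Rightarrow> 'a bop" is minus
  by (simp add: blinfun.diff_left scaleC_diff_right)
lift_definition uminus_bop :: "'a bop \<Rightarrow> 'a bop" is uminus
  by (simp add: blinfun.minus_left scaleC_minus_right)
lift_definition scaleR_bop :: "real \<Rightarrow> 'a bop \<Rightarrow> 'a bop" is scaleR
  by (simp add: blinfun.scaleR_left scaleC_scaleR_commute)
lift_definition times_bop :: "'a bop \<Rightarrow> 'a bop \<Rightarrow> 'a bop" is blinfun_compose
  by simp
lift_definition norm_bop :: "'a bop \<Rightarrow> real" is norm .
definition dist_bop :: "'a bop \<Rightarrow> 'a bop \<Rightarrow> real" where "dist_bop S T = norm (S - T)"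
definition sgn_bop :: "'a bop \<Rightarrow> 'a bop" where "sgn_bop T = scaleR (inverse (norm T)) T"
definition uniformity_bop :: "('a bop \<times> 'a bop) filter" where
  "uniformity_bop = (INF e\<in>{0<..}. principal {(S, T). dist S T < e})"
definition open_bop :: "'a bop set \<Rightarrow> bool" where
  "open_bop U = (\<forall>S\<in>U. \<forall>\<^sub>F (S', T) in uniformity. S' = S \<longrightarrow> T \<in> U)"
instance
proof
  fix a b c :: "'a bop" and r s :: real
  show "a + b + c = a + (b + c)" by transfer simp
  show "a + b = b + a" by transfer simp
  show "0 + a = a" by transfer simp
  show "- a + a = 0" by transfer simp
  show "a - b = a + - b" by transfer simp
  show "r *\<^sub>R (a + b) = r *\<^sub>R a + r *\<^sub>R b" by transfer (simp add: scaleR_add_right)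
  show "(r + s) *\<^sub>R a = r *\<^sub>R a + s *\<^sub>R a" by transfer (simp add: scaleR_add_left)
  show "r *\<^sub>R s *\<^sub>R a = (r * s) *\<^sub>R a" by transfer simp
  show "1 *\<^sub>R a = a" by transfer simp
  show "a * b * c = a * (b * c)" by transfer (simp add: blinfun_eqI)
  show "(a + b) * c = a * c + b * c"
    by transfer (simp add: blinfun_eqI blinfun.add_left)
  show "a * (b + c) = a * b + a * c"
    by transfer (simp add: blinfun_eqI blinfun.add_left blinfun.add_right)
  show "(r *\<^sub>R a) * b = r *\<^sub>R (a * b)"
    by transfer (simp add: blinfun_eqI blinfun.scaleR_left)
  show "a * (r *\<^sub>R b) = r *\<^sub>R (a * b)"
    by transfer (simp add: blinfun_eqI blinfun.scaleR_left blinfun.scaleR_right)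
  show "dist a b = norm (a - b)" by (rule dist_bop_def)
  show "sgn a = scaleR (inverse (norm a)) a" by (rule sgn_bop_def)
  show "(uniformity :: ('a bop \<times> 'a bop) filter)
      = (INF e\<in>{0<..}. principal {(S, T). dist S T < e})"
    by (rule uniformity_bop_def)
  show "open U = (\<forall>S\<in>U. \<forall>\<^sub>F (S', T) in uniformity. S' = S \<longrightarrow> T \<in> U)" for U :: "'a bop set"
    by (rule open_bop_def)
  show "(norm a = 0) = (a = 0)" by transfer simp
  show "norm (a + b) \<le> norm a + norm b" by transfer (rule norm_triangle_ineq)
  show "norm (r *\<^sub>R a) = \<bar>r\<bar> * norm a" by transfer simp
  show "norm (a * b) \<le> norm a * norm b" by transfer (rule norm_blinfun_compose)
qed
end

instance bop :: (complex_banach) banach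
proof
  fix S :: "nat \<Rightarrow> 'a bop"
  assume "Cauchy S"
  have dist: "dist (blinfun_of_bop a) (blinfun_of_bop b) = dist a b" for a b :: "'a bop"
    by (simp add: dist_norm norm_bop.rep_eq minus_bop.rep_eq)
  have "Cauchy (\<lambda>n. blinfun_of_bop (S n))"
    using \<open>Cauchy S\<close> by (simp add: Cauchy_def dist)
  then obtain L where L: "(\<lambda>n. blinfun_of_bop (S n)) \<longlonglongrightarrow> L"
    using Cauchy_convergent_iff convergent_def by blast
  have lim: "(\<lambda>n. blinfun_of_bop (S n) x) \<longlonglongrightarrow> L x" for x
    by (intro blinfun.tendsto L tendsto_const)
  have "L (c *\<^sub>C x) = c *\<^sub>C L x" for c x
  proof (rule LIMSEQ_unique)
    show "(\<lambda>n. blinfun_of_bop (S n) (c *\<^sub>C x)) \<longlonglongrightarrow> L (c *\<^sub>C x)" by (rule lim)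
    have "blinfun_of_bop (S n) (c *\<^sub>C x) = c *\<^sub>C blinfun_of_bop (S n) x" for n
      using blinfun_of_bop[of "S n"] by simp
    then show "(\<lambda>n. blinfun_of_bop (S n) (c *\<^sub>C x)) \<longlonglongrightarrow> c *\<^sub>C L x"
      using bounded_linear.tendsto[OF bounded_linear_scaleC_right lim] by simp
  qed
  then have "blinfun_of_bop (Bop L) = L"
    by (simp add: Bop_inverse)
  then have "S \<longlonglongrightarrow> Bop L"
    using L by (simp add: tendsto_iff flip: dist)
  then show "convergent S" by (auto simp: convergent_def)
qed

instantiation bop :: (complex_banach) complex_banach_algebra
begin
lift_definition one_bop :: "'a bop" is id_blinfun by simp
lift_definition scaleC_bop :: "complex \<Rightarrow> 'a bop \<Rightarrow> 'a bop" is scaleC_blinfun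
  by (simp add: scaleC_blinfun.rep_eq scaleC_scaleC mult.commute)
instance
proof
  fix a b :: "'a bop" and c d :: complex and r :: real
  show "1 * a = a" by transfer (simp add: blinfun_eqI)
  show "a * 1 = a" by transfer (simp add: blinfun_eqI)
  show "c *\<^sub>C (a + b) = c *\<^sub>C a + c *\<^sub>C b"
    by transfer (simp add: blinfun_eqI scaleC_blinfun.rep_eq blinfun.add_left scaleC_add_right)
  show "(c + d) *\<^sub>C a = c *\<^sub>C a + d *\<^sub>C a"
    by transfer (simp add: blinfun_eqI scaleC_blinfun.rep_eq blinfun.add_left scaleC_add_left)
  show "c *\<^sub>C d *\<^sub>C a = (c * d) *\<^sub>C a"
    by transfer (simp add: blinfun_eqI scaleC_blinfun.rep_eq scaleC_scaleC)
  show "complex_of_real r *\<^sub>C a = r *\<^sub>R a"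
    by transfer (simp add: blinfun_eqI scaleC_blinfun.rep_eq scaleC_of_real blinfun.scaleR_left)
  show "norm (c *\<^sub>C a) = cmod c * norm a" by transfer (rule norm_scaleC_blinfun)
  show "(c *\<^sub>C a) * b = c *\<^sub>C (a * b)"
    by transfer (simp add: blinfun_eqI scaleC_blinfun.rep_eq)
  show "a * (c *\<^sub>C b) = c *\<^sub>C (a * b)"
    by transfer (simp add: blinfun_eqI scaleC_blinfun.rep_eq)
qed
end

definition op_range :: "'a::complex_banach bop \<Rightarrow> 'a set" where
  "op_range T = range (bop_apply T)"

definition op_kernel :: "'a::complex_banach bop \<Rightarrow> 'a set" where
  "op_kernel T = {x. bop_apply T x = 0}"

end

theory Submission
  imports Defs
begin

text \<open>
  Write \<open>D\<close> for the weighted Moore-Penrose inverse and \<open>G\<close> for the group inverse of \<open>T\<close>. An inner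
  and outer inverse of \<open>T\<close> that commutes with \<open>T\<close> is the group inverse, so being weighted EP means
  \<open>D = G\<close>, and the theorem compares two generalized inverses of the same element.

  The comparison takes place in the decomposition of \<open>X\<close> into \<open>R(T)\<close> and \<open>N(T)\<close> given by the
  idempotent \<open>TG\<close>. The idempotent \<open>TD\<close> has the same range \<open>R(T)\<close> and \<open>DT\<close> the same kernel \<open>N(T)\<close>,
  and \<open>D = (DT) G (TD)\<close>, so \<open>D = G\<close> as soon as \<open>TD = TG\<close> and \<open>DT = TG\<close>
  (\<open>eq_g_of_projections\<close>). All powers of \<open>T\<close> and \<open>G\<close> with positive exponent are invertible in the
  corner algebra \<open>TG L(X) TG\<close> and can be cancelled there. Hence if one such power \<open>c\<close> has a left
  factor \<open>D\<close>, then \<open>DTc = c\<close> and \<open>DT = TG\<close>; a right factor \<open>D\<close> gives \<open>TD = TG\<close>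
  (\<open>eq_g_of_corner_unit_factors\<close>). Most of the identities exhibit both factors directly; the
  others do so after multiplication by \<open>T\<close>, \<open>G\<close> or \<open>TG\<close>.

  For the statements on ranges and null spaces, \<open>\<mu>T + T\<^sup>3\<close> factors through \<open>T\<close> on both sides.
  So \<open>R(T + \<mu>B) \<subseteq> R(T)\<close>, which forces \<open>TG B = B\<close>, and \<open>N(T) \<subseteq> N(T + \<mu>B)\<close>, which forces
  \<open>B TG = B\<close>; together these give \<open>B = G\<close> (\<open>eq_group_inverse_iff_range_kernel\<close>).

  Analysis enters only through the uniqueness of the weighted Moore-Penrose inverse. It rests on the
  fact that two hermitian idempotents with the same range, or the same kernel, are equal
  (\<open>hermitian_idempotents_eq\<close>): the product of the reflections \<open>1 - 2p\<close> and \<open>1 - 2q\<close> is then a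
  contraction of the form \<open>1 + n\<close> with \<open>n\<^sup>2 = 0\<close>, and boundedness of the powers \<open>1 + mn\<close>
  forces \<open>n = 0\<close>.
\<close>

section \<open>Hermitian idempotents\<close>

lemma scaleC_cancel:
  fixes x y :: "'a::complex_banach"
  assumes "c \<noteq> 0" "c *\<^sub>C x = c *\<^sub>C y"
  shows "x = y"
proof -
  have "norm (c *\<^sub>C (x - y)) = 0" using assms(2) by (simp add: scaleC_diff_right)
  then show ?thesis using assms(1) by (simp add: norm_scaleC)
qed

lemma scaleC_one: "(1::complex) *\<^sub>C (x::'a::complex_banach) = x"
  using scaleC_of_real[of 1 x] by simp

lemma bounded_linear_scaleC_left:
  fixes x :: "'a::complex_banach"
  shows "bounded_linear (\<lambda>c. c *\<^sub>C x)"
proof (rule bounded_linear_intro[where K = "norm x"])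
  show "(r *\<^sub>R c) *\<^sub>C x = r *\<^sub>R c *\<^sub>C x" for r c
    by (metis scaleC_of_real scaleC_scaleC scaleR_conv_of_real)
qed (simp_all add: scaleC_add_left norm_scaleC)

lemma power_scaleC_idempotent:
  fixes p :: "'a::complex_banach_algebra"
  assumes "p * p = p"
  shows "(z *\<^sub>C p) ^ Suc n = z ^ Suc n *\<^sub>C p"
  by (induction n) (simp_all add: assms mult_scaleC_left mult_scaleC_right scaleC_scaleC mult.commute)

lemma banach_exp_idempotent:
  fixes p :: "'a::complex_banach_algebra"
  assumes "p * p = p"
  shows "banach_exp (z *\<^sub>C p) = 1 - p + exp z *\<^sub>C p"
proof -
  have summand: "(z *\<^sub>C p) ^ n /\<^sub>R fact n = (if n = 0 then 1 - p else 0) + (z ^ n /\<^sub>R fact n) *\<^sub>C p" for n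
  proof (cases n)
    case 0
    then show ?thesis by (simp add: scaleC_one)
  next
    case (Suc m)
    have "(z ^ n /\<^sub>R fact n) *\<^sub>C p = (z ^ n *\<^sub>C p) /\<^sub>R fact n"
      by (metis scaleC_of_real scaleC_scaleC scaleR_conv_of_real)
    then show ?thesis using power_scaleC_idempotent[OF assms, of z m] Suc by simp
  qed
  have "(\<lambda>n. (z ^ n /\<^sub>R fact n) *\<^sub>C p) sums (exp z *\<^sub>C p)"
    by (rule bounded_linear.sums[OF bounded_linear_scaleC_left exp_converges])
  then have "(\<lambda>n. (z *\<^sub>C p) ^ n /\<^sub>R fact n) sums (1 - p + exp z *\<^sub>C p)"
    unfolding summand by (intro sums_add sums_single[of 0 "\<lambda>_. 1 - p", simplified])
  then show ?thesis
    unfolding banach_exp_def by (rule sums_unique[symmetric])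
qed

text \<open>At \<open>t = \<pi>\<close> the exponential \<open>exp(itp) = 1 - p + exp(it) p\<close> is the reflection
  \<open>1 - 2p\<close>. This single value of \<open>t\<close> carries all the information about \<open>p\<close> that is used below.\<close>

lemma hermitian_idempotent_reflection:
  fixes p :: "'a::complex_banach_algebra"
  assumes "hermitian_wrt N p" "p * p = p"
  shows "N (1 - 2 *\<^sub>R p) = 1"
proof -
  have "banach_exp ((\<i> * complex_of_real pi) *\<^sub>C p) = 1 - p + (-1) *\<^sub>C p"
    using banach_exp_idempotent[OF assms(2), of "\<i> * complex_of_real pi"]
    by (simp add: mult.commute[of \<i>])
  also have "(-1) *\<^sub>C p = - p"
    using scaleC_of_real[of "-1" p] by simp
  also have "1 - p + - p = 1 - 2 *\<^sub>R p"
    by (simp add: scaleR_2)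
  finally show ?thesis
    using assms(1) unfolding hermitian_wrt_def by metis
qed

text \<open>The powers of \<open>1 + y\<close> are \<open>1 + my\<close>, which grow linearly unless \<open>y\<close> vanishes.\<close>

lemma square_zero_perturbation_of_one:
  fixes y :: "'a::complex_banach_algebra"
  assumes "y * y = 0" "norm (1 + y) \<le> 1"
  shows "y = 0"
proof -
  have pow: "(1 + y) ^ Suc m = 1 + real (Suc m) *\<^sub>R y" for m
    by (induction m) (simp_all add: algebra_simps scaleR_2 assms(1))
  have bound: "norm ((1 + y) ^ Suc m) \<le> 1" for m
  proof (induction m)
    case (Suc m)
    have "norm ((1 + y) ^ Suc (Suc m)) \<le> norm (1 + y) * norm ((1 + y) ^ Suc m)"
      by (metis norm_mult_ineq power_Suc)
    also have "\<dots> \<le> 1" using Suc assms(2) by (simp add: mult_le_one)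
    finally show ?case .
  qed (use assms(2) in simp)
  have est: "real (Suc m) * norm y \<le> 1 + norm (1::'a)" for m
  proof -
    have "real (Suc m) *\<^sub>R y = (1 + y) ^ Suc m - 1" unfolding pow by simp
    then have "norm (real (Suc m) *\<^sub>R y) \<le> norm ((1 + y) ^ Suc m) + norm (1::'a)"
      by (metis norm_triangle_ineq4)
    then show ?thesis using bound[of m] by simp
  qed
  show ?thesis
  proof (rule ccontr)
    assume "y \<noteq> 0"
    then obtain m where "1 + norm (1::'a) < real m * norm y"
      using reals_Archimedean3[of "norm y"] by auto
    also have "\<dots> \<le> real (Suc m) * norm y" by (simp add: mult_right_mono)
    finally show False using est[of m] by simp
  qed
qed

lemma inverse_elt_inverse:
  assumes "invertible_elt u"
  shows "u * inverse_elt u = 1" "inverse_elt u * u = 1"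
proof -
  obtain v where v: "u * v = 1 \<and> v * u = 1" using assms invertible_elt_def by blast
  have "u * inverse_elt u = 1 \<and> inverse_elt u * u = 1"
    unfolding inverse_elt_def
  proof (rule theI[of _ v])
    show "w = v" if "u * w = 1 \<and> w * u = 1" for w
      using that v by (metis mult.assoc mult_1_left mult_1_right)
  qed (rule v)
  then show "u * inverse_elt u = 1" "inverse_elt u * u = 1" by auto
qed

lemma invertible_positive_sqrt:
  assumes "invertible_elt u" "has_positive_sqrt u"
  shows "invertible_elt (positive_sqrt u)"
proof -
  have sq: "positive_sqrt u * positive_sqrt u = u"
    using theI'[OF assms(2)[unfolded has_positive_sqrt_def]] by (simp add: positive_sqrt_def)
  obtain v where v: "u * v = 1" "v * u = 1" using assms(1) invertible_elt_def by blast
  have "positive_sqrt u * (positive_sqrt u * v) = 1" "(v * positive_sqrt u) * positive_sqrt u = 1"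
    using v sq by (metis mult.assoc)+
  moreover from this have "positive_sqrt u * v = v * positive_sqrt u"
    by (metis mult.assoc mult_1_left mult_1_right)
  ultimately show ?thesis unfolding invertible_elt_def by metis
qed

text \<open>The hypothesis on the products says that \<open>p\<close> and \<open>q\<close> have the same range, or that they have
  the same kernel. In both cases \<open>(p - q)\<^sup>2 = 0\<close>, and the product of the two reflections is
  \<open>1 - 2(p - q)\<close> in the first case and \<open>1 + 2(p - q)\<close> in the second. Conjugation by the square
  root of \<open>u\<close> moves the argument from the weighted norm to the original one.\<close>

lemma hermitian_idempotents_eq:
  fixes p q u :: "'a::complex_banach_algebra"
  assumes u: "invertible_elt u" "has_positive_sqrt u"
    and herm: "hermitian_wrt (weighted_norm u) p" "hermitian_wrt (weighted_norm u) q"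
    and idem: "p * p = p" "q * q = q"
    and rel: "p * q = q \<and> q * p = p \<or> p * q = p \<and> q * p = q"
  shows "p = q"
proof -
  define r where "r = positive_sqrt u"
  define r' where "r' = inverse_elt r"
  have r: "r * r' = 1" "r' * r = 1"
    using inverse_elt_inverse invertible_positive_sqrt[OF u] by (auto simp: r_def r'_def)
  have cancel: "r' * (r * x) = x" for x by (simp add: r flip: mult.assoc)
  define n where "n = (1 - 2 *\<^sub>R p) * (1 - 2 *\<^sub>R q) - 1"
  have n: "n = - 2 *\<^sub>R (p - q) \<or> n = 2 *\<^sub>R (p - q)"
    using rel by (auto simp: n_def algebra_simps scaleR_2 simp flip: scaleR_2)
  have "(p - q) * (p - q) = 0" using rel idem by (auto simp: algebra_simps)
  then have nn: "n * n = 0" using n by auto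
  define y where "y = r * n * r'"
  have "y * y = r * (n * n) * r'" by (simp add: y_def mult.assoc cancel)
  then have "y * y = 0" by (simp add: nn)
  moreover have "norm (1 + y) \<le> 1"
  proof -
    have "1 + y = r * ((1 - 2 *\<^sub>R p) * (1 - 2 *\<^sub>R q)) * r'"
      by (simp add: y_def n_def right_diff_distrib left_diff_distrib r)
    also have "\<dots> = (r * (1 - 2 *\<^sub>R p) * r') * (r * (1 - 2 *\<^sub>R q) * r')"
      by (simp only: mult.assoc cancel)
    finally have "norm (1 + y) \<le> norm (r * (1 - 2 *\<^sub>R p) * r') * norm (r * (1 - 2 *\<^sub>R q) * r')"
      by (metis norm_mult_ineq)
    also have "\<dots> = 1"
      using hermitian_idempotent_reflection[OF herm(1) idem(1)]
        hermitian_idempotent_reflection[OF herm(2) idem(2)]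
      by (simp add: weighted_norm_def r_def r'_def)
    finally show ?thesis .
  qed
  ultimately have "y = 0" by (rule square_zero_perturbation_of_one)
  moreover have "n = r' * y * r" by (simp add: y_def mult.assoc cancel r)
  ultimately show ?thesis using n by auto
qed

section \<open>Uniqueness of weighted Moore-Penrose and group inverses\<close>

text \<open>For two weighted Moore-Penrose inverses \<open>b\<close> and \<open>c\<close>, the idempotents \<open>ab\<close> and \<open>ac\<close> have the
  same range, while \<open>ba\<close> and \<open>ca\<close> have the same kernel.\<close>

lemma weighted_MP_inverse_unique:
  assumes "invertible_elt e" "invertible_elt f"
    and b: "weighted_MP_inverse e f a b" and c: "weighted_MP_inverse e f a c"
  shows "b = c"
proof -
  note b = b[unfolded weighted_MP_inverse_def] and c = c[unfolded weighted_MP_inverse_def]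
  have "a * b = a * c"
  proof (rule hermitian_idempotents_eq[of e])
    show "a * b * (a * c) = a * c \<and> a * c * (a * b) = a * b \<or>
        a * b * (a * c) = a * b \<and> a * c * (a * b) = a * c"
      using b c by (metis mult.assoc)
  qed (use assms(1) b c in \<open>auto simp flip: mult.assoc\<close>)
  moreover have "b * a = c * a"
  proof (rule hermitian_idempotents_eq[of f])
    show "b * a * (c * a) = c * a \<and> c * a * (b * a) = b * a \<or>
        b * a * (c * a) = b * a \<and> c * a * (b * a) = c * a"
      using b c by (metis mult.assoc)
  qed (use assms(2) b c in \<open>auto simp flip: mult.assoc\<close>)
  ultimately show ?thesis using b c by (metis mult.assoc)
qed

lemma weighted_MP_eqI:
  assumes "invertible_elt e" "invertible_elt f" "weighted_MP_inverse e f a b"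
  shows "weighted_MP e f a = b"
  unfolding weighted_MP_def
  using assms(3) weighted_MP_inverse_unique[OF assms(1,2)] by blast

lemma weighted_MP_inverse_weighted_MP:
  assumes "invertible_elt e" "invertible_elt f" "weighted_MP_invertible e f a"
  shows "weighted_MP_inverse e f a (weighted_MP e f a)"
  using assms weighted_MP_eqI unfolding weighted_MP_invertible_def by metis

lemma is_group_inverse_unique:
  assumes b: "is_group_inverse a b" and c: "is_group_inverse a c"
  shows "b = c"
proof -
  note b = b[unfolded is_group_inverse_def] and c = c[unfolded is_group_inverse_def]
  have "a * b = a * c"
    using b c by (metis mult.assoc)
  then show ?thesis using b c by (metis mult.assoc)
qed

lemma is_group_inverse_group_inverse:
  assumes "group_invertible a"
  shows "is_group_inverse a (group_inverse a)"
  using assms is_group_inverse_unique unfolding group_invertible_def group_inverse_def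
  by (metis theI)

section \<open>When a generalized inverse is the group inverse\<close>

locale generalized_and_group_inverse =
  fixes a b g :: "'a::complex_banach_algebra"
  assumes aba: "a * b * a = a" and bab: "b * a * b = b"
    and group_inv: "is_group_inverse a g"
begin

text \<open>Rewrite rules that bring words in \<open>a\<close>, \<open>b\<close>, \<open>g\<close>, bracketed to the right, to a reduced form.
  Each relation occurs twice, at the end of a word and in front of a further factor. Besides the
  defining relations there are \<open>abg = g\<close> and \<open>gba = g\<close>: the element \<open>g\<close> starts and ends with a
  factor \<open>a\<close>, which absorbs \<open>ab\<close> and \<open>ba\<close> respectively.\<close>

lemma words:
  "a * (b * a) = a" "a * (b * (a * x)) = a * x"
  "b * (a * b) = b" "b * (a * (b * x)) = b * x"
  "g * a = a * g" "g * (a * x) = a * (g * x)"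
  "a * (a * g) = a" "a * (a * (g * x)) = a * x"
  "a * (g * g) = g" "a * (g * (g * x)) = g * x"
  "a * (b * g) = g" "a * (b * (g * x)) = g * x"
  "g * (b * a) = g" "g * (b * (a * x)) = g * x"
proof -
  note gi = group_inv[unfolded is_group_inverse_def]
  show 1: "a * (b * a) = a" using aba by (simp add: mult.assoc)
  then show "a * (b * (a * x)) = a * x" by (metis mult.assoc)
  show 2: "b * (a * b) = b" using bab by (simp add: mult.assoc)
  then show "b * (a * (b * x)) = b * x" by (metis mult.assoc)
  show 3: "g * a = a * g" using gi by simp
  then show "g * (a * x) = a * (g * x)" by (metis mult.assoc)
  show 4: "a * (a * g) = a" using gi by (metis mult.assoc)
  then show "a * (a * (g * x)) = a * x" by (metis mult.assoc)
  show 5: "a * (g * g) = g" using gi by (metis mult.assoc)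
  then show "a * (g * (g * x)) = g * x" by (metis mult.assoc)
  show 6: "a * (b * g) = g" using 5 1 by (metis mult.assoc)
  then show "a * (b * (g * x)) = g * x" by (metis mult.assoc)
  show 7: "g * (b * a) = g" using 5 3 1 by (metis mult.assoc)
  then show "g * (b * (a * x)) = g * x" by (metis mult.assoc)
qed

text \<open>If \<open>b\<close> commutes with \<open>a\<close>, it satisfies the definition of the group inverse, which is
  unique.\<close>

lemma commute_iff: "a * b = b * a \<longleftrightarrow> b = g"
proof
  assume "a * b = b * a"
  then have "is_group_inverse a b" using aba bab by (auto simp: is_group_inverse_def)
  then show "b = g" by (rule is_group_inverse_unique[OF _ group_inv])
qed (simp add: words)

lemma eq_g_of_projections:
  assumes "a * b = a * g" "b * a = a * g"
  shows "b = g"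
  using assms commute_iff by simp

text \<open>The invertible elements of the algebra \<open>s A s\<close> with unit \<open>s = ag\<close>. On operators they are the
  operators that vanish on \<open>N(a)\<close> and restrict to automorphisms of \<open>R(a)\<close>. An
  inverse \<open>c'\<close> in \<open>A\<close> suffices, because \<open>s c' s\<close> is then one in the corner.\<close>

definition corner_unit :: "'a \<Rightarrow> bool" where
  "corner_unit c \<longleftrightarrow> (\<exists>c'. c * c' = a * g \<and> c' * c = a * g) \<and> a * g * c = c \<and> c * (a * g) = c"

lemma corner_unit_mult:
  assumes "corner_unit c" "corner_unit d"
  shows "corner_unit (c * d)"
proof -
  obtain c' d' where c': "c * c' = a * g" "c' * c = a * g" and d': "d * d' = a * g" "d' * d = a * g"
    using assms unfolding corner_unit_def by auto
  have c: "a * g * c = c" "c * (a * g) = c" and d: "a * g * d = d" "d * (a * g) = d"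
    using assms unfolding corner_unit_def by auto
  have "(c * d) * (d' * c') = c * (a * g) * c'" by (metis d'(1) mult.assoc)
  moreover have "(d' * c') * (c * d) = d' * (a * g * d)" by (metis c'(2) mult.assoc)
  ultimately have "(c * d) * (d' * c') = a * g \<and> (d' * c') * (c * d) = a * g"
    by (simp only: c d c' d')
  then show ?thesis
    unfolding corner_unit_def using c d by (metis mult.assoc)
qed

lemma corner_unit_a: "corner_unit a" and corner_unit_g: "corner_unit g"
  unfolding corner_unit_def using words by (metis mult.assoc)+

lemma corner_unit_power:
  assumes "corner_unit c" "k \<ge> 1"
  shows "corner_unit (c ^ k)"
  using assms(2) by (induction k rule: dec_induct) (simp_all add: assms(1) corner_unit_mult)

text \<open>The idempotents \<open>ab\<close> and \<open>ag\<close> have the same range and \<open>ba\<close> and \<open>ag\<close> the same kernel, so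
  \<open>ab\<close> is a left unit and \<open>ba\<close> a right unit for the corner. The opposite units, \<open>ba\<close> on the left
  and \<open>ab\<close> on the right, are what the equality \<open>b = g\<close> requires.\<close>

lemma corner_unit_words:
  assumes "corner_unit c"
  shows "a * (b * c) = c" "a * (b * (c * x)) = c * x" "a * (g * c) = c" "a * (g * (c * x)) = c * x"
    "c * (b * a) = c" "c * (b * (a * x)) = c * x" "c * (a * g) = c" "c * (a * (g * x)) = c * x"
proof -
  have c: "a * g * c = c" "c * (a * g) = c" using assms unfolding corner_unit_def by auto
  show 1: "a * (g * c) = c" using c by (simp add: mult.assoc)
  show 2: "c * (a * g) = c" by (rule c)
  show 3: "a * (b * c) = c" using 1 words(2) by metis
  show 4: "c * (b * a) = c" using 2 words(13) mult.assoc by metis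
  show "a * (b * (c * x)) = c * x" "a * (g * (c * x)) = c * x"
    "c * (b * (a * x)) = c * x" "c * (a * (g * x)) = c * x"
    using 1 2 3 4 by (metis mult.assoc)+
qed

text \<open>A corner unit can be cancelled, so fixing one of them amounts to fixing \<open>ag\<close>; and
  \<open>ba ag = ba\<close> because the kernels agree.\<close>

lemma corner_unit_fixed_left:
  assumes "corner_unit c" "b * (a * c) = c"
  shows "b * a = a * g"
proof -
  obtain c' where "c * c' = a * g" using assms(1) unfolding corner_unit_def by auto
  then have "b * (a * (a * g)) = a * g" using assms(2) by (metis mult.assoc)
  then show ?thesis by (simp add: words)
qed

lemma corner_unit_fixed_right:
  assumes "corner_unit c" "c * (a * b) = c"
  shows "a * b = a * g"
proof -
  obtain c' where "c' * c = a * g" using assms(1) unfolding corner_unit_def by auto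
  then have "a * g * (a * b) = a * g" using assms(2) by (metis mult.assoc)
  then show ?thesis by (simp add: words mult.assoc)
qed

text \<open>This criterion settles all identities in which some power of \<open>a\<close> or \<open>g\<close> is written as a
  product that begins with \<open>b\<close> and as one that ends with \<open>b\<close>: a leading \<open>b\<close> is fixed by
  \<open>ba\<close>, a final one by \<open>ab\<close>.\<close>

lemma eq_g_of_corner_unit_factors:
  assumes "corner_unit c" "c = b * x" "c = y * b"
  shows "b = g"
proof (rule eq_g_of_projections)
  show "a * b = a * g"
    by (rule corner_unit_fixed_right[OF assms(1)]) (simp add: assms(3) words mult.assoc)
  show "b * a = a * g"
    by (rule corner_unit_fixed_left[OF assms(1)]) (simp add: assms(2) words)
qed

text \<open>Since \<open>c = cba = abc\<close>, moving \<open>b\<close> past \<open>c\<close> brings it to the other end of the product.\<close>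

lemma eq_g_of_corner_unit_commutes:
  assumes c: "corner_unit c" and h: "c * b = b * c"
  shows "b = g"
proof (rule eq_g_of_corner_unit_factors[OF c])
  have "c = (c * b) * a" by (simp add: corner_unit_words[OF c] mult.assoc)
  then show "c = b * (c * a)" by (simp add: h mult.assoc)
  have "c = a * (b * c)" by (simp add: corner_unit_words[OF c])
  then show "c = (a * c) * b" by (simp add: mult.assoc flip: h)
qed

lemma eq_g_iff_group_projection_commutes: "b = g \<longleftrightarrow> a * g * b = b * g * a"
proof
  assume h: "a * g * b = b * g * a"
  have "a * (a * g * b) = a * (b * g * a)" "(a * g * b) * a = (b * g * a) * a" by (simp_all add: h)
  then have "a * b = a * g" "a * g = b * a" by (simp_all add: words mult.assoc)
  then show "b = g" by (intro eq_g_of_projections) simp_all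
qed (simp add: words mult.assoc)

lemma eq_g_iff_projections_commute: "b = g \<longleftrightarrow> a * b * b * a = b * a * a * b"
proof
  assume h: "a * b * b * a = b * a * a * b"
  have "(a * b * b * a) * (a * g) = (b * a * a * b) * (a * g)"
    "(a * g) * (a * b * b * a) = (a * g) * (b * a * a * b)" by (simp_all only: h)
  from this[unfolded mult.assoc words] have "a * b = b * a" by simp
  then show "b = g" using commute_iff by simp
qed (simp add: words mult.assoc)

lemma eq_g_iff_mean: "b = g \<longleftrightarrow> b * g * a + a * g * b = 2 *\<^sub>R b"
proof
  assume h: "b * g * a + a * g * b = 2 *\<^sub>R b"
  have "a * (b * g * a + a * g * b) = a * (2 *\<^sub>R b)" "(b * g * a + a * g * b) * a = (2 *\<^sub>R b) * a"
    by (simp_all only: h)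
  from this[unfolded distrib_left distrib_right scaleR_2 mult.assoc words]
  show "b = g" by (intro eq_g_of_projections) simp_all
qed (simp add: words mult.assoc scaleR_2)

text \<open>The identity \<open>bgb = gb\<^sup>2\<close> first yields \<open>ab ba = ag\<close>. With this relation every \<open>ab\<^sup>2a\<close> can
  be replaced by \<open>ag\<close>, and the two identities reduce to \<open>ag = ab\<close> and \<open>ba = ag\<close> after
  multiplication by \<open>a\<^sup>3\<close> on the left and on the right respectively.\<close>

lemma eq_g_iff_square_g: "b = g \<longleftrightarrow> b\<^sup>2 * g = b * g * b \<and> b * g * b = g * b\<^sup>2"
proof
  assume h: "b\<^sup>2 * g = b * g * b \<and> b * g * b = g * b\<^sup>2"
  have "a * a * (b * g * b) * a = a * a * (g * b\<^sup>2) * a" using h by simp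
  then have pq: "a * (b * (b * a)) = a * g"
    by (simp add: words mult.assoc power2_eq_square)
  then have bba: "a * (b * (b * (a * x))) = a * (g * x)" for x by (metis mult.assoc)
  have gbba: "g * (b * (b * (a * x))) = g * (g * x)" for x
  proof -
    \<comment> \<open>\<open>g = gga\<close> provides the factor \<open>a\<close> that \<open>ab\<^sup>2a = ag\<close> needs.\<close>
    have "g * (g * (a * (b * (b * (a * x))))) = g * (g * (a * (g * x)))" by (simp only: bba)
    then show ?thesis by (simp add: words)
  qed
  from bba[of "g * g"] have bbg: "a * (b * (b * g)) = g * g" by (simp add: words)
  have "a * a * a * (b\<^sup>2 * g) = a * a * a * (b * g * b)" "b * g * b * a * a * a = g * b\<^sup>2 * a * a * a"
    using h by simp_all
  from this[unfolded power2_eq_square mult.assoc bbg gbba words]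
  show "b = g" by (intro eq_g_of_projections) simp_all
qed (simp add: power2_eq_square mult.assoc)

lemma eq_g_iff_corner_unit_mean:
  assumes c: "corner_unit c"
  shows "b = g \<longleftrightarrow> c * a * b + b * a * c = 2 *\<^sub>R c"
proof
  assume h: "c * a * b + b * a * c = 2 *\<^sub>R c"
  have "a * g * (c * a * b + b * a * c) = a * g * (2 *\<^sub>R c)"
    "(c * a * b + b * a * c) * (a * g) = (2 *\<^sub>R c) * (a * g)"
    by (simp_all only: h)
  then have "c * (a * b) = c" "b * (a * c) = c"
    by (simp_all add: words corner_unit_words[OF c] mult.assoc distrib_left distrib_right scaleR_2)
  then show "b = g"
    using eq_g_of_projections corner_unit_fixed_left[OF c] corner_unit_fixed_right[OF c] by blast
next
  assume "b = g"
  then show "c * a * b + b * a * c = 2 *\<^sub>R c"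
    by (simp add: corner_unit_words[OF c] words mult.assoc scaleR_2)
qed

text \<open>As \<open>ab c = c\<close> and \<open>b ab = b\<close>, the identity reads
  \<open>c + \<mu> ab\<^sup>2 = c ab + \<mu> b\<close>. Multiplication by \<open>ag\<close> on the left changes only the last term, so
  \<open>b = agb\<close>; then \<open>ab\<^sup>2 = b\<close>, and \<open>c = c ab\<close> remains. For the companion identity below the
  multiplication is on the right.\<close>

lemma eq_g_iff_range_projection_commutes:
  assumes c: "corner_unit c" and "\<mu> \<noteq> 0"
  shows "b = g \<longleftrightarrow> a * b * (c + \<mu> *\<^sub>C b) = (c + \<mu> *\<^sub>C b) * a * b"
proof
  assume h: "a * b * (c + \<mu> *\<^sub>C b) = (c + \<mu> *\<^sub>C b) * a * b"
  then have 1: "c + \<mu> *\<^sub>C (a * (b * b)) = c * (a * b) + \<mu> *\<^sub>C b"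
    by (simp add: distrib_left distrib_right mult_scaleC_left mult_scaleC_right
        corner_unit_words[OF c] words mult.assoc)
  then have "a * g * (c + \<mu> *\<^sub>C (a * (b * b))) = a * g * (c * (a * b) + \<mu> *\<^sub>C b)" by simp
  then have "c + \<mu> *\<^sub>C (a * (b * b)) = c * (a * b) + \<mu> *\<^sub>C (a * (g * b))"
    by (simp add: distrib_left mult_scaleC_right corner_unit_words[OF c] words mult.assoc)
  with 1 have "\<mu> *\<^sub>C b = \<mu> *\<^sub>C (a * (g * b))" by simp
  then have b: "a * (g * b) = b" using scaleC_cancel[OF assms(2)] by metis
  have "a * (b * b) = b" using b words(2,12) by metis
  with 1 have right: "c * (a * b) = c" by simp
  have "b * a = a * (g * (b * a))" using b by (metis mult.assoc)
  then have "b * a = a * g" by (simp add: words)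
  with corner_unit_fixed_right[OF c right] show "b = g" by (rule eq_g_of_projections)
next
  assume "b = g"
  then show "a * b * (c + \<mu> *\<^sub>C b) = (c + \<mu> *\<^sub>C b) * a * b"
    by (simp add: distrib_left distrib_right mult_scaleC_left mult_scaleC_right
        corner_unit_words[OF c] words mult.assoc)
qed

lemma eq_g_iff_kernel_projection_commutes:
  assumes c: "corner_unit c" and "\<mu> \<noteq> 0"
  shows "b = g \<longleftrightarrow> b * a * (c + \<mu> *\<^sub>C b) = (c + \<mu> *\<^sub>C b) * b * a"
proof
  assume h: "b * a * (c + \<mu> *\<^sub>C b) = (c + \<mu> *\<^sub>C b) * b * a"
  then have 1: "b * (a * c) + \<mu> *\<^sub>C b = c + \<mu> *\<^sub>C (b * (b * a))"
    by (simp add: distrib_left distrib_right mult_scaleC_left mult_scaleC_right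
        corner_unit_words[OF c] words mult.assoc)
  then have "(b * (a * c) + \<mu> *\<^sub>C b) * (a * g) = (c + \<mu> *\<^sub>C (b * (b * a))) * (a * g)" by simp
  then have "b * (a * c) + \<mu> *\<^sub>C (b * (a * g)) = c + \<mu> *\<^sub>C (b * (b * a))"
    by (simp add: distrib_right mult_scaleC_left corner_unit_words[OF c] words mult.assoc)
  with 1 have "\<mu> *\<^sub>C b = \<mu> *\<^sub>C (b * (a * g))" by (metis add_left_cancel)
  then have b: "b * (a * g) = b" using scaleC_cancel[OF assms(2)] by metis
  have "b * (b * a) = b * (a * g) * (b * a)" by (simp only: b)
  also have "\<dots> = b * (a * g)" by (simp only: words mult.assoc)
  finally have "b * (b * a) = b" by (simp only: b)
  with 1 have left: "b * (a * c) = c" by simp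
  have "a * b = a * (b * (a * g))" by (simp add: b)
  then have "a * b = a * g" by (simp add: words)
  then show "b = g" using corner_unit_fixed_left[OF c left] by (rule eq_g_of_projections)
next
  assume "b = g"
  then show "b * a * (c + \<mu> *\<^sub>C b) = (c + \<mu> *\<^sub>C b) * b * a"
    by (simp add: distrib_left distrib_right mult_scaleC_left mult_scaleC_right
        corner_unit_words[OF c] words mult.assoc)
qed

lemma a_power_commutes: "a ^ k * a = a * a ^ k" "a ^ k * g = g * a ^ k"
  subgoal by (rule power_commutes)
  subgoal by (rule power_commuting_commutes) (simp add: words)
  done

lemma g_power_commutes: "g ^ k * a = a * g ^ k" "g ^ k * g = g * g ^ k"
  subgoal by (rule power_commuting_commutes) (simp add: words)
  subgoal by (rule power_commutes)
  done

end

section \<open>Operators: ranges and null spaces\<close>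

lemma bop_apply_mult: "bop_apply (S * U) x = bop_apply S (bop_apply U x)"
  by transfer simp

lemma bop_apply_diff_right: "bop_apply S (x - y) = bop_apply S x - bop_apply S y"
  by transfer (simp add: blinfun.diff_right)

lemma bop_apply_zero_right: "bop_apply S 0 = 0"
  by transfer simp

lemma bop_eqI: "(\<And>x. bop_apply S x = bop_apply U x) \<Longrightarrow> S = U"
  by transfer (rule blinfun_eqI)

lemma op_range_mult_subset: "op_range (S * U) \<subseteq> op_range S"
  by (auto simp: op_range_def bop_apply_mult)

lemma op_kernel_mult_subset: "op_kernel U \<subseteq> op_kernel (S * U)"
  by (auto simp: op_kernel_def bop_apply_mult bop_apply_zero_right)

text \<open>The next two facts turn inclusions of ranges and null spaces into operator identities. They
  are applied with the idempotent \<open>P = TG\<close>.\<close>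

lemma left_multiplier_of_range_subset:
  assumes "op_range S \<subseteq> op_range U" "P * U = U"
  shows "P * S = S"
proof (rule bop_eqI)
  fix x
  obtain y where "bop_apply S x = bop_apply U y"
    using assms(1) unfolding op_range_def by blast
  then show "bop_apply (P * S) x = bop_apply S x"
    by (metis assms(2) bop_apply_mult)
qed

lemma right_multiplier_of_kernel_subset:
  assumes "op_kernel U \<subseteq> op_kernel S" "U * P = U"
  shows "S * P = S"
proof (rule bop_eqI)
  fix x
  have "bop_apply U (x - bop_apply P x) = 0"
    by (simp add: bop_apply_diff_right assms(2) flip: bop_apply_mult)
  then have "bop_apply S (x - bop_apply P x) = 0"
    using assms(1) unfolding op_kernel_def by blast
  then show "bop_apply (S * P) x = bop_apply S x"
    by (simp add: bop_apply_diff_right bop_apply_mult)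
qed

text \<open>For \<open>B = G\<close> the two operators differ by factors on either side:
  \<open>T + \<mu>G = (\<mu>T + T\<^sup>3) G\<^sup>2\<close> and \<open>\<mu>T + T\<^sup>3 = (T + \<mu>G) T\<^sup>2\<close>, and all factors commute.
  For the converse, \<open>\<mu>T + T\<^sup>3\<close> is replaced by \<open>T\<close>, its left and right factor, so that \<open>TG\<close>
  fixes \<open>T + \<mu>B\<close> from both sides; as it also fixes \<open>T\<close>, it fixes \<open>B\<close>.\<close>

lemma eq_group_inverse_iff_range_kernel:
  fixes T B G :: "'x::complex_banach bop"
  assumes TBT: "T * B * T = T" and BTB: "B * T * B = B" and G: "is_group_inverse T G"
    and mu: "\<mu> \<noteq> 0"
  shows "B = G \<longleftrightarrow> op_range (T + \<mu> *\<^sub>C B) = op_range (\<mu> *\<^sub>C T + T^3) \<and>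
    op_kernel (T + \<mu> *\<^sub>C B) = op_kernel (\<mu> *\<^sub>C T + T^3)"
proof -
  interpret generalized_and_group_inverse T B G
    using assms by unfold_locales
  have factor_left: "\<mu> *\<^sub>C T + T^3 = T * (\<mu> *\<^sub>C 1 + T^2)"
    and factor_right: "\<mu> *\<^sub>C T + T^3 = (\<mu> *\<^sub>C 1 + T^2) * T"
    by (simp_all add: distrib_left distrib_right mult_scaleC_left mult_scaleC_right
        power2_eq_square power3_eq_cube mult.assoc)
  show ?thesis
  proof
    assume eq: "B = G"
    have "T + \<mu> *\<^sub>C G = (\<mu> *\<^sub>C T + T^3) * (G * G)" "T + \<mu> *\<^sub>C G = (G * G) * (\<mu> *\<^sub>C T + T^3)"
      "\<mu> *\<^sub>C T + T^3 = (T + \<mu> *\<^sub>C G) * (T * T)" "\<mu> *\<^sub>C T + T^3 = (T * T) * (T + \<mu> *\<^sub>C G)"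
      by (simp_all add: distrib_left distrib_right mult_scaleC_left mult_scaleC_right
        power3_eq_cube mult.assoc words add.commute)
    then show "op_range (T + \<mu> *\<^sub>C B) = op_range (\<mu> *\<^sub>C T + T^3) \<and>
        op_kernel (T + \<mu> *\<^sub>C B) = op_kernel (\<mu> *\<^sub>C T + T^3)"
      unfolding eq by (metis op_range_mult_subset op_kernel_mult_subset subset_antisym)
  next
    assume h: "op_range (T + \<mu> *\<^sub>C B) = op_range (\<mu> *\<^sub>C T + T^3) \<and>
      op_kernel (T + \<mu> *\<^sub>C B) = op_kernel (\<mu> *\<^sub>C T + T^3)"
    have "op_range (T + \<mu> *\<^sub>C B) \<subseteq> op_range T"
      unfolding conjunct1[OF h] factor_left by (rule op_range_mult_subset)
    then have "T * G * (T + \<mu> *\<^sub>C B) = T + \<mu> *\<^sub>C B"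
      by (rule left_multiplier_of_range_subset) (simp add: words mult.assoc)
    then have "\<mu> *\<^sub>C (T * (G * B)) = \<mu> *\<^sub>C B"
      by (simp add: distrib_left mult_scaleC_right words mult.assoc)
    then have "T * (G * B) = B" by (rule scaleC_cancel[OF mu])
    then have BT: "B * T = T * G" by (metis mult.assoc words(5,13))
    have "op_kernel T \<subseteq> op_kernel (T + \<mu> *\<^sub>C B)"
      unfolding conjunct2[OF h] factor_right by (rule op_kernel_mult_subset)
    then have "(T + \<mu> *\<^sub>C B) * (T * G) = T + \<mu> *\<^sub>C B"
      by (rule right_multiplier_of_kernel_subset) (simp add: words)
    then have "\<mu> *\<^sub>C (B * (T * G)) = \<mu> *\<^sub>C B"
      by (simp add: distrib_right mult_scaleC_left words)
    then have "B * (T * G) = B" by (rule scaleC_cancel[OF mu])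
    then have "T * B = T * G" by (metis words(2))
    then show "B = G" using BT by (rule eq_g_of_projections)
  qed
qed

section \<open>The characterisations\<close>

theorem theorem3p6:
  fixes E F T :: "'x::complex_banach bop" and k l :: nat and \<mu> :: complex
  assumes "invertible_elt E" and "positive_elt E"
    and "invertible_elt F" and "positive_elt F"
    and "weighted_MP_invertible E F T" and "group_invertible T"
    and "k \<ge> 1" and "l \<ge> 1" and "\<mu> \<noteq> 0"
  shows "let D = weighted_MP E F T; G = group_inverse T in
    (weighted_EP E F T \<longleftrightarrow> T * G * D = D * G * T) \<and>
    (weighted_EP E F T \<longleftrightarrow> T * D * D * T = D * T * T * D) \<and>
    (weighted_EP E F T \<longleftrightarrow> D * G * T + T * G * D = 2 *\<^sub>R D) \<and>
    (weighted_EP E F T \<longleftrightarrow> D^2 * G = D * G * D \<and> D * G * D = G * D^2) \<and>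
    (weighted_EP E F T \<longleftrightarrow> T * D^2 = G \<and> G = D^2 * T) \<and>
    (weighted_EP E F T \<longleftrightarrow> T^k = D * T * T^k \<and> D * T * T^k = T^k * T * D) \<and>
    (weighted_EP E F T \<longleftrightarrow> D^k = G^k) \<and>
    (weighted_EP E F T \<longleftrightarrow> G^k * D = D * G^k) \<and>
    (weighted_EP E F T \<longleftrightarrow> T^k * D = D * T^k) \<and>
    (weighted_EP E F T \<longleftrightarrow> T^(2 * k - 1) = D * T^(2 * k + 1) * D) \<and>
    (weighted_EP E F T \<longleftrightarrow> G^k * D * T = D^k) \<and>
    (weighted_EP E F T \<longleftrightarrow> T * D^(k + 1) = G^k \<and> G^k = D^(k + 1) * T) \<and>
    (weighted_EP E F T \<longleftrightarrow> T^k * T * D + D * T * T^k = 2 *\<^sub>R T^k) \<and>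
    (weighted_EP E F T \<longleftrightarrow>
       G^(k + l - 1) = D^l * G^(k - 1) \<and> D^l * G^(k - 1) = G^(k - 1) * D^l) \<and>
    (weighted_EP E F T \<longleftrightarrow>
       T * D * G^(k + l - 1) = D^k * G^l * T \<and> D^k * G^l * T = G^l * T * D^k) \<and>
    (weighted_EP E F T \<longleftrightarrow>
       T * D * (T^k + \<mu> *\<^sub>C D) = (T^k + \<mu> *\<^sub>C D) * T * D) \<and>
    (weighted_EP E F T \<longleftrightarrow>
       D * T * (T^k + \<mu> *\<^sub>C D) = (T^k + \<mu> *\<^sub>C D) * D * T) \<and>
    (weighted_EP E F T \<longleftrightarrow>
       weighted_MP_invertible E E T \<and> weighted_MP_invertible F F T \<and>
       op_range (T + \<mu> *\<^sub>C weighted_MP E E T) = op_range (T + \<mu> *\<^sub>C weighted_MP F F T) \<and>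
       op_range (T + \<mu> *\<^sub>C weighted_MP F F T) = op_range (\<mu> *\<^sub>C T + T^3) \<and>
       op_kernel (T + \<mu> *\<^sub>C weighted_MP E E T) = op_kernel (T + \<mu> *\<^sub>C weighted_MP F F T) \<and>
       op_kernel (T + \<mu> *\<^sub>C weighted_MP F F T) = op_kernel (\<mu> *\<^sub>C T + T^3)) \<and>
    (weighted_EP E F T \<longleftrightarrow>
       op_range (T + \<mu> *\<^sub>C D) = op_range (\<mu> *\<^sub>C T + T^3) \<and>
       op_kernel (T + \<mu> *\<^sub>C D) = op_kernel (\<mu> *\<^sub>C T + T^3))"
proof -
  define D where "D = weighted_MP E F T"
  define G where "G = group_inverse T"
  have D: "weighted_MP_inverse E F T D"
    unfolding D_def by (rule weighted_MP_inverse_weighted_MP) (use assms in auto)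
  have G: "is_group_inverse T G"
    unfolding G_def by (rule is_group_inverse_group_inverse) (rule assms)
  interpret generalized_and_group_inverse T D G
    using D G by unfold_locales (auto simp: weighted_MP_inverse_def)
  have EP: "weighted_EP E F T \<longleftrightarrow> D = G"
    using assms(5) commute_iff by (simp add: weighted_EP_def D_def)
  have Tk: "corner_unit (T ^ k)" and Gk: "corner_unit (G ^ k)"
    using assms corner_unit_power corner_unit_a corner_unit_g by auto
  obtain m where k: "k = Suc m" using assms(7) not0_implies_Suc by fastforce
  obtain n where l: "l = Suc n" using assms(8) not0_implies_Suc by fastforce
  have Gkl: "corner_unit (G ^ (k + l - 1))" and Tkk: "corner_unit (T ^ (2 * k - 1))"
    using assms corner_unit_power corner_unit_a corner_unit_g by auto

  have 1: "D = G \<longleftrightarrow> T * G * D = D * G * T"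
    by (rule eq_g_iff_group_projection_commutes)
  have 2: "D = G \<longleftrightarrow> T * D * D * T = D * T * T * D"
    by (rule eq_g_iff_projections_commute)
  have 3: "D = G \<longleftrightarrow> D * G * T + T * G * D = 2 *\<^sub>R D"
    by (rule eq_g_iff_mean)
  have 4: "D = G \<longleftrightarrow> D^2 * G = D * G * D \<and> D * G * D = G * D^2"
    by (rule eq_g_iff_square_g)
  have 5: "D = G \<longleftrightarrow> T * D^2 = G \<and> G = D^2 * T"
    using eq_g_of_corner_unit_factors[OF corner_unit_g, of "D * T" "T * D"]
    by (auto simp: power2_eq_square mult.assoc words)
  have 6: "D = G \<longleftrightarrow> T^k = D * T * T^k \<and> D * T * T^k = T^k * T * D" (is "_ \<longleftrightarrow> ?R")
  proof
    assume ?R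
    then show "D = G"
      using eq_g_of_corner_unit_factors[OF Tk, of "T * T^k" "T^k * T"] by (metis mult.assoc)
  next
    assume "D = G"
    then show ?R using corner_unit_words[OF Tk] by (simp add: words mult.assoc)
  qed
  have 7: "D = G \<longleftrightarrow> D^k = G^k"
    using eq_g_of_corner_unit_factors[OF Gk, of "D ^ m" "D ^ m"]
    by (auto simp: k power_commutes)
  have 8: "D = G \<longleftrightarrow> G^k * D = D * G^k"
    using eq_g_of_corner_unit_commutes[OF Gk] g_power_commutes by auto
  have 9: "D = G \<longleftrightarrow> T^k * D = D * T^k"
    using eq_g_of_corner_unit_commutes[OF Tk] a_power_commutes by auto
  have 10: "D = G \<longleftrightarrow> T^(2 * k - 1) = D * T^(2 * k + 1) * D" (is "_ \<longleftrightarrow> ?R")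
  proof
    assume ?R
    then show "D = G"
      using eq_g_of_corner_unit_factors[OF Tkk, of "T^(2 * k + 1) * D" "D * T^(2 * k + 1)"]
      by (simp add: mult.assoc)
  next
    assume "D = G"
    have "2 * k + 1 = Suc (Suc (2 * k - 1))" using assms(7) by simp
    then have "T^(2 * k + 1) = T * T^(2 * k - 1) * T" by (metis power_Suc power_Suc2)
    then show ?R using \<open>D = G\<close> corner_unit_words[OF Tkk] by (simp add: words mult.assoc)
  qed
  have 11: "D = G \<longleftrightarrow> G^k * D * T = D^k"
    using 7 corner_unit_words[OF Gk] by (metis mult.assoc)
  have 12: "D = G \<longleftrightarrow> T * D^(k + 1) = G^k \<and> G^k = D^(k + 1) * T" (is "_ \<longleftrightarrow> ?R")
  proof
    assume ?R
    then have "G^k = D * (D ^ k * T)" "G^k = (T * D ^ k) * D"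
      by (auto simp: mult.assoc power_commutes)
    then show "D = G" by (rule eq_g_of_corner_unit_factors[OF Gk])
  next
    assume "D = G"
    then show ?R
      using corner_unit_words[OF Gk] by (simp add: g_power_commutes mult.assoc words)
  qed
  have 13: "D = G \<longleftrightarrow> T^k * T * D + D * T * T^k = 2 *\<^sub>R T^k"
    by (rule eq_g_iff_corner_unit_mean[OF Tk])
  have 14: "D = G \<longleftrightarrow> G^(k + l - 1) = D^l * G^(k - 1) \<and> D^l * G^(k - 1) = G^(k - 1) * D^l"
    (is "_ \<longleftrightarrow> ?R")
  proof
    assume ?R
    then have "G^(k + l - 1) = D * (D^n * G^m)" "G^(k + l - 1) = (G^m * D^n) * D"
      by (auto simp: k l mult.assoc power_commutes)
    then show "D = G" by (rule eq_g_of_corner_unit_factors[OF Gkl])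
  next
    assume "D = G"
    moreover have "k + l - 1 = l + (k - 1)" "k + l - 1 = (k - 1) + l" using assms(7) by auto
    ultimately show ?R by (metis power_add)
  qed
  have 15: "D = G \<longleftrightarrow>
      T * D * G^(k + l - 1) = D^k * G^l * T \<and> D^k * G^l * T = G^l * T * D^k" (is "_ \<longleftrightarrow> ?R")
  proof
    assume ?R
    then have "G^(k + l - 1) = D^k * G^l * T" "G^(k + l - 1) = G^l * T * D^k"
      using corner_unit_words(1)[OF Gkl] by (simp_all add: mult.assoc)
    then have "G^(k + l - 1) = D * (D^m * G^l * T)" "G^(k + l - 1) = (G^l * T * D^m) * D"
      by (simp_all only: k power_Suc power_Suc2 mult.assoc power_commutes)
    then show "D = G" by (rule eq_g_of_corner_unit_factors[OF Gkl])
  next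
    assume "D = G"
    have "k + l = Suc (k + l - 1)" using assms(7) by simp
    then have "G^k * G^l * T = G^(k + l - 1) * G * T" "G^l * G^k * T = G^(k + l - 1) * G * T"
      by (metis power_add power_Suc2 add.commute)+
    moreover have "G^(k + l - 1) * G * T = G^(k + l - 1)"
      using corner_unit_words(7)[OF Gkl] by (simp add: words mult.assoc)
    moreover have "G^l * T * G^k = G^l * G^k * T" by (metis g_power_commutes(1) mult.assoc)
    ultimately show ?R
      using \<open>D = G\<close> corner_unit_words(1)[OF Gkl] by (simp add: mult.assoc)
  qed
  have 16: "D = G \<longleftrightarrow> T * D * (T^k + \<mu> *\<^sub>C D) = (T^k + \<mu> *\<^sub>C D) * T * D"
    by (rule eq_g_iff_range_projection_commutes[OF Tk assms(9)])
  have 17: "D = G \<longleftrightarrow> D * T * (T^k + \<mu> *\<^sub>C D) = (T^k + \<mu> *\<^sub>C D) * D * T"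
    by (rule eq_g_iff_kernel_projection_commutes[OF Tk assms(9)])
  have 19: "D = G \<longleftrightarrow> op_range (T + \<mu> *\<^sub>C D) = op_range (\<mu> *\<^sub>C T + T^3) \<and>
      op_kernel (T + \<mu> *\<^sub>C D) = op_kernel (\<mu> *\<^sub>C T + T^3)"
    by (rule eq_group_inverse_iff_range_kernel[OF aba bab G assms(9)])
  have 18: "D = G \<longleftrightarrow> weighted_MP_invertible E E T \<and> weighted_MP_invertible F F T \<and>
      op_range (T + \<mu> *\<^sub>C weighted_MP E E T) = op_range (T + \<mu> *\<^sub>C weighted_MP F F T) \<and>
      op_range (T + \<mu> *\<^sub>C weighted_MP F F T) = op_range (\<mu> *\<^sub>C T + T^3) \<and>
      op_kernel (T + \<mu> *\<^sub>C weighted_MP E E T) = op_kernel (T + \<mu> *\<^sub>C weighted_MP F F T) \<and>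
      op_kernel (T + \<mu> *\<^sub>C weighted_MP F F T) = op_kernel (\<mu> *\<^sub>C T + T^3)" (is "_ \<longleftrightarrow> ?R")
  proof
    assume "D = G"
    then have "weighted_MP_inverse E E T G" "weighted_MP_inverse F F T G"
      using D G unfolding weighted_MP_inverse_def is_group_inverse_def by metis+
    moreover from this have "weighted_MP E E T = D" "weighted_MP F F T = D"
      using weighted_MP_eqI assms(1,3) \<open>D = G\<close> by metis+
    ultimately show ?R
      using 19 \<open>D = G\<close> unfolding weighted_MP_invertible_def by metis
  next
    assume R: ?R
    have EE: "weighted_MP_inverse E E T (weighted_MP E E T)"
      and FF: "weighted_MP_inverse F F T (weighted_MP F F T)"
      using R assms(1,3) weighted_MP_inverse_weighted_MP by metis+
    have "weighted_MP E E T = G" "weighted_MP F F T = G"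
      by (rule eq_group_inverse_iff_range_kernel[THEN iffD2, OF _ _ G assms(9)];
        use EE FF R in \<open>simp add: weighted_MP_inverse_def\<close>)+
    \<comment> \<open>The weight \<open>E\<close> constrains only \<open>T G\<close> and the weight \<open>F\<close> only \<open>G T\<close>, so the two
      conditions on \<open>G\<close> combine to the one with mixed weights.\<close>
    with EE FF have "weighted_MP_inverse E F T G"
      unfolding weighted_MP_inverse_def by metis
    then show "D = G" using D weighted_MP_inverse_unique[OF assms(1,3)] by metis
  qed
  show ?thesis
    unfolding Let_def EP D_def[symmetric] G_def[symmetric]
    by (intro conjI; fact)
qed

end
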